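(* Under the standing assumptions in the context, let $\beta\in(0,1)$ and let the sequence $(x_k)_{k\ge0}$ be generated by PSGA (from $x_0\in\mathcal{T}_\beta$) with step-sizes satisfying $\sum_k\alpha_k=\infty$, $\sum_k\alpha_k^2<\infty$, and $$0<\alpha_k\le\min\{1,2(1-\beta)\tau\}\Big(\frac{\beta\mu}{\rho G_h}\Big)^{1/\nu}\quad\text{for all }k.$$ Then $\lim_{k\to\infty}\operatorname{dist}(x_k;\mathcal{X}^* )=0$, $\lim_{k\to\infty}f(x_k)=f^*$, and all cluster points of $(x_k)$ (if any) are global optimal solutions, i.e. belong to $\mathcal{X}^*$.
   Context: Notation: $\|\cdot\|$ is the Euclidean norm on $\mathbb{R}^n$, $\operatorname{dist}(x;S)=\inf_{z\in S}\|z-x\|$, $\operatorname{proj}_S(x)=\operatorname{argmin}_{z\in S}\|z-x\|$ (a set in general). $\partial f(x)$ is the Fréchet subdifferential: all $\zeta$ with $f(y)\ge f(x)+\langle\zeta,y-x\rangle+o(\|y-x\|)$ as $y\to x$. Standing assumptions: $h:\mathbb{R}^n\to\mathbb{R}\cup\{+\infty\}$ is a Legendre kernel: proper, lower semicontinuous, strictly convex, continuously differentiable on $\operatorname{int}\operatorname{dom}(h)\ne\emptyset$, and essentially smooth ($\|\nabla h(x_k)\|\to\infty$ whenever $x_k\in\operatorname{int}\operatorname{dom}(h)$ converges to a boundary point of $\operatorname{dom}(h)$). $D_h(x,y)=h(x)-h(y)-\langle\nabla h(y),x-y\rangle$ for $y\in\operatorname{int}\operatorname{dom}(h)$. $X\subseteq\operatorname{int}\operatorname{dom}(h)$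 is nonempty, closed and convex. $f:\mathbb{R}^n\to\mathbb{R}\cup\{+\infty\}$ is proper (not assumed differentiable), $\rho>0$, and $f+\rho h$ is convex on $\operatorname{int}\operatorname{dom}(h)$ ($f$ is $\rho$-weakly convex relative to $h$); $f$ is finite and locally Lipschitz around every point of $X$. $f^*:=\inf_Xf>-\infty$ and $\mathcal{X}^*:=\{x\in X:f(x)=f^*\}\neq\emptyset$. Sharpness: $\mu>0$ and $\mu\operatorname{dist}(x;\mathcal{X}^* )\le f(x)-f^*$ for all $x\in X$. Local Bregman growth: $\nu\in(0,1]$, $G_h>0$ and $\inf_{y\in\operatorname{proj}_{\mathcal{X}^*}(x)}D_h(y,x)\le G_h\operatorname{dist}^{1+\nu}(x;\mathcal{X}^* )$ for all $x\in X$ with $\operatorname{dist}(x;\mathcal{X}^* )<(\mu/(\rho G_h))^{1/\nu}$. For $\beta\in(0,1]$, $\mathcal{T}_\beta:=\{x\in X:\operatorname{dist}(x;\mathcal{X}^* )<(\beta\mu/(\rho G_h))^{1/\nu}\}$. $L:=\sup\{\|\zeta\|:\zeta\in\partial f(x),\,x\in\mathcal{T}_1\}$, assumed to satisfy $0<L<\infty$, and $\tau:=\mu/L$. PSGA (projected subgradient algorithm): given $\beta\in(0,1)$, $x_0\in\mathcal{T}_\beta$ and step-sizes $\alpha_k>0$, for $k=0,1,2,\dots$ choose any $\zeta_k\in\partial f(x_k)$ and set $x_{k+1}=\operatorname{proj}_X\big(x_k-\alpha_k\zeta_k/\|\zeta_k\|\big)$ (with $x_{k+1}=x_k$ if $\zeta_k=0$).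 *)

theory Defs
  imports "HOL-Analysis.Analysis" "HOL-Library.Landau_Symbols"
begin

text \<open>
  Functions into the reals with plus infinity are rendered as functions into \<^typ>\<open>ereal\<close>;
  \<open>proper\<close> excludes the value minus infinity.
\<close>

definition effdom :: "('a \<Rightarrow> ereal) \<Rightarrow> 'a set" where
  "effdom f = {x. f x < \<infinity>}"

definition proper :: "('a \<Rightarrow> ereal) \<Rightarrow> bool" where
  "proper f \<longleftrightarrow> (\<forall>x. f x \<noteq> -\<infinity>) \<and> effdom f \<noteq> {}"

definition lower_semicont :: "('a::topological_space \<Rightarrow> ereal) \<Rightarrow> bool" where
  "lower_semicont f \<longleftrightarrow> (\<forall>x. f x \<le> Liminf (at x) f)"

definition ereal_convex_on :: "'a::real_vector set \<Rightarrow> ('a \<Rightarrow> ereal) \<Rightarrow> bool" where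
  "ereal_convex_on S f \<longleftrightarrow> convex S \<and>
     (\<forall>x\<in>S. \<forall>y\<in>S. \<forall>t::real. 0 < t \<and> t < 1 \<longrightarrow>
        f ((1 - t) *\<^sub>R x + t *\<^sub>R y) \<le> ereal (1 - t) * f x + ereal t * f y)"

definition ereal_strictly_convex :: "('a::real_vector \<Rightarrow> ereal) \<Rightarrow> bool" where
  "ereal_strictly_convex f \<longleftrightarrow>
     (\<forall>x\<in>effdom f. \<forall>y\<in>effdom f. \<forall>t::real. x \<noteq> y \<and> 0 < t \<and> t < 1 \<longrightarrow>
        f ((1 - t) *\<^sub>R x + t *\<^sub>R y) < ereal (1 - t) * f x + ereal t * f y)"

text \<open>
  \<^const>\<open>real_of_ereal\<close> sends the infinite values to 0, so \<open>grad f x\<close> is the gradient of \<open>f\<close> only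
  at points around which \<open>f\<close> is finite; it is used on the interior of the domain only.
\<close>

definition grad :: "('a::real_inner \<Rightarrow> ereal) \<Rightarrow> 'a \<Rightarrow> 'a" where
  "grad f x = (THE D. GDERIV (\<lambda>y. real_of_ereal (f y)) x :> D)"

definition legendre_kernel :: "('a::euclidean_space \<Rightarrow> ereal) \<Rightarrow> bool" where
  "legendre_kernel h \<longleftrightarrow>
     proper h \<and> lower_semicont h \<and> ereal_strictly_convex h \<and>
     interior (effdom h) \<noteq> {} \<and>
     (\<forall>x\<in>interior (effdom h). (\<lambda>y. real_of_ereal (h y)) differentiable (at x)) \<and>
     continuous_on (interior (effdom h)) (grad h) \<and>
     (\<forall>u z. (\<forall>k::nat. u k \<in> interior (effdom h)) \<and> z \<in> frontier (effdom h) \<and>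
        u \<longlonglongrightarrow> z \<longrightarrow> filterlim (\<lambda>k. norm (grad h (u k))) at_top sequentially)"

definition bregman :: "('a::real_inner \<Rightarrow> ereal) \<Rightarrow> 'a \<Rightarrow> 'a \<Rightarrow> ereal" where
  "bregman h x y = h x - h y - ereal (grad h y \<bullet> (x - y))"

definition rel_weakly_convex ::
  "real \<Rightarrow> ('a::euclidean_space \<Rightarrow> ereal) \<Rightarrow> ('a \<Rightarrow> ereal) \<Rightarrow> bool" where
  "rel_weakly_convex \<rho> h f \<longleftrightarrow>
     ereal_convex_on (interior (effdom h)) (\<lambda>x. f x + ereal \<rho> * h x)"

definition finite_lipschitz_around :: "('a::metric_space \<Rightarrow> ereal) \<Rightarrow> 'a \<Rightarrow> bool" where
  "finite_lipschitz_around f x \<longleftrightarrow>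
     (\<exists>e>0. \<exists>K. (\<forall>y\<in>ball x e. \<bar>f y\<bar> \<noteq> \<infinity>) \<and>
        K-lipschitz_on (ball x e) (\<lambda>y. real_of_ereal (f y)))"

definition frechet_subdiff :: "('a::real_inner \<Rightarrow> ereal) \<Rightarrow> 'a \<Rightarrow> 'a set" where
  "frechet_subdiff f x = {\<zeta>. \<bar>f x\<bar> \<noteq> \<infinity> \<and>
     (\<exists>r. r \<in> o[at x](\<lambda>y. norm (y - x)) \<and>
        (\<forall>\<^sub>F y in at x. f y \<ge> f x + ereal (\<zeta> \<bullet> (y - x)) + ereal (r y)))}"

definition proj :: "'a::real_normed_vector set \<Rightarrow> 'a \<Rightarrow> 'a set" where
  "proj S x = {z. is_arg_min (\<lambda>z. norm (z - x)) (\<lambda>z. z \<in> S) z}"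

definition minimizers :: "'a set \<Rightarrow> ('a \<Rightarrow> ereal) \<Rightarrow> 'a set" where
  "minimizers X f = {x \<in> X. f x = (INF z\<in>X. f z)}"

definition tube ::
  "'a::metric_space set \<Rightarrow> 'a set \<Rightarrow> real \<Rightarrow> real \<Rightarrow> real \<Rightarrow> real \<Rightarrow> real \<Rightarrow> 'a set" where
  "tube X Xs \<mu> \<rho> G \<nu> \<beta> = {x \<in> X. infdist x Xs < (\<beta> * \<mu> / (\<rho> * G)) powr (1 / \<nu>)}"

text \<open>For closed convex nonempty \<open>X\<close> the set \<open>proj X y\<close> is a singleton, so the membership below
  determines the next iterate.\<close>

definition psga ::
  "'a::real_inner set \<Rightarrow> ('a \<Rightarrow> ereal) \<Rightarrow> (nat \<Rightarrow> real) \<Rightarrow> (nat \<Rightarrow> 'a) \<Rightarrow> bool" where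
  "psga X f \<alpha> x \<longleftrightarrow>
     (\<exists>\<zeta>. \<forall>k. \<zeta> k \<in> frechet_subdiff f (x k) \<and>
        (if \<zeta> k = 0 then x (Suc k) = x k
         else x (Suc k) \<in> proj X (x k - (\<alpha> k / norm (\<zeta> k)) *\<^sub>R \<zeta> k)))"

end

theory Submission
  imports Defs
begin

text \<open>
  A Frechet subgradient \<open>\<zeta>\<close> of \<open>f\<close> at \<open>x\<close> satisfies the global inequality
  \<open>f y \<ge> f x + \<zeta> \<bullet> (y - x) - \<rho> D\<^sub>h(y, x)\<close>, because \<open>\<zeta> + \<rho> \<nabla>h(x)\<close> is a subgradient of the
  convex function \<open>f + \<rho> h\<close>. Applied at a nearest minimizer \<open>y\<close>, together with sharpness and the
  growth bound on \<open>D\<^sub>h\<close>, it shows that the squared distance \<open>d\<^sub>k\<^sup>2\<close> to the minimizers obeys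
  \<open>d\<^sub>k\<^sub>+\<^sub>1\<^sup>2 \<le> d\<^sub>k\<^sup>2 - 2 (1 - \<beta>) \<tau> \<alpha>\<^sub>k d\<^sub>k + \<alpha>\<^sub>k\<^sup>2\<close> as long as \<open>d\<^sub>k\<close> is at most the radius of the tube. The
  right-hand side is convex in \<open>d\<^sub>k\<close>, so checking both endpoints shows that the closed tube is
  invariant; the recursion then forces \<open>d\<^sub>k \<rightarrow> 0\<close>. The subgradient inequality also bounds
  \<open>f x\<^sub>k - f\<^sup>*\<close> by \<open>L d\<^sub>k + \<rho> G d\<^sub>k\<^bsup>1 + \<nu>\<^esup>\<close>, so no compactness of the minimizers is needed.
\<close>

text \<open>Summable errors make the squares converge. A positive limit is then excluded by the
  divergence of the step sums: near it, each step would remove a fixed multiple of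
  \<open>\<alpha> k\<close> from the square, up to a summable error.\<close>

lemma tendsto_zero_of_square_recursion:
  fixes d \<alpha> :: "nat \<Rightarrow> real"
  assumes d0: "\<And>k. 0 \<le> d k" and a0: "\<And>k. 0 < \<alpha> k" and c: "0 < c"
    and rec: "\<And>k. (d (Suc k))\<^sup>2 \<le> (d k)\<^sup>2 - c * \<alpha> k * d k + (\<alpha> k)\<^sup>2"
    and div: "filterlim (\<lambda>n. \<Sum>k<n. \<alpha> k) at_top sequentially"
    and sq: "summable (\<lambda>k. (\<alpha> k)\<^sup>2)"
  shows "d \<longlonglongrightarrow> 0"
proof -
  define A where "A n = (\<Sum>k<n. (\<alpha> k)\<^sup>2)" for n
  have A_lim: "A \<longlonglongrightarrow> suminf (\<lambda>k. (\<alpha> k)\<^sup>2)"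
    unfolding A_def using sq by (rule summable_LIMSEQ)
  have A_le: "A n \<le> suminf (\<lambda>k. (\<alpha> k)\<^sup>2)" for n
    unfolding A_def using sq by (intro sum_le_suminf) auto
  \<comment> \<open>The squares themselves need not decrease. Subtracting the accumulated errors
    \<open>A\<close> leaves a monotone sequence that is bounded below because \<open>A\<close> is
    bounded above.\<close>
  have "decseq (\<lambda>n. (d n)\<^sup>2 - A n)"
  proof (rule decseq_SucI)
    fix n
    have "0 \<le> c * \<alpha> n * d n"
      using c a0[of n] d0[of n] by simp
    then show "(d (Suc n))\<^sup>2 - A (Suc n) \<le> (d n)\<^sup>2 - A n"
      using rec[of n] by (simp add: A_def)
  qed
  moreover have "- suminf (\<lambda>k. (\<alpha> k)\<^sup>2) \<le> (d n)\<^sup>2 - A n" for n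
    using A_le[of n] zero_le_power2[of "d n"] by linarith
  ultimately obtain l where "(\<lambda>n. (d n)\<^sup>2 - A n) \<longlonglongrightarrow> l"
    using decseq_convergent by blast
  from tendsto_add[OF this A_lim] obtain m where "(\<lambda>n. (d n)\<^sup>2) \<longlonglongrightarrow> m"
    by auto
  from tendsto_real_sqrt[OF this] have d_lim: "d \<longlonglongrightarrow> sqrt m"
    by (simp add: d0)
  then have "0 \<le> sqrt m"
    using d0 by (intro LIMSEQ_le_const) auto
  moreover have "\<not> 0 < sqrt m"
  proof
    assume "0 < sqrt m"
    define e where "e = sqrt m / 2"
    have e: "0 < e" "e < sqrt m"
      using \<open>0 < sqrt m\<close> by (auto simp: e_def)
    from order_tendstoD(1)[OF d_lim e(2)] obtain N where N: "\<And>n. N \<le> n \<Longrightarrow> e < d n"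
      by (auto simp: eventually_sequentially)
    define B where "B n = (\<Sum>k<n. \<alpha> k)" for n
    \<comment> \<open>Past \<open>N\<close> the decrease per step is at least
      \<open>c * e * \<alpha> n\<close> minus the error, so adding \<open>c * e * B n\<close> still
      gives a nonincreasing potential. Since \<open>A\<close> is bounded, this bounds
      \<open>B\<close>.\<close>
    have step: "(d n)\<^sup>2 - A n + c * e * B n \<le> (d N)\<^sup>2 - A N + c * e * B N" if "N \<le> n" for n
      using that
    proof (induction n rule: dec_induct)
      case (step n)
      have "c * \<alpha> n * e \<le> c * \<alpha> n * d n"
        using N[of n] step.hyps c a0[of n] by (intro mult_left_mono) auto
      then show ?case
        using step.IH rec[of n] by (simp add: A_def B_def algebra_simps)
    qed simp
    define M where "M = ((d N)\<^sup>2 - A N + c * e * B N + suminf (\<lambda>k. (\<alpha> k)\<^sup>2)) / (c * e)"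
    have "B n \<le> M" if "N \<le> n" for n
    proof -
      have "c * e * B n \<le> (d N)\<^sup>2 - A N + c * e * B N + suminf (\<lambda>k. (\<alpha> k)\<^sup>2)"
        using step[OF that] A_le[of n] zero_le_power2[of "d n"] by linarith
      then show ?thesis
        using c e(1) by (simp add: M_def pos_le_divide_eq mult.commute)
    qed
    moreover have "eventually (\<lambda>n. M < B n) sequentially"
      using div unfolding B_def filterlim_at_top_dense by blast
    ultimately show False
      by (metis eventually_sequentially nle_le not_less)
  qed
  ultimately show ?thesis
    using d_lim by simp
qed

section \<open>Metric projections\<close>

lemma proj_nonexpansive:
  fixes X :: "'a::euclidean_space set"
  assumes "convex X" "closed X" "u \<in> proj X w" "y \<in> X"
  shows "norm (u - y) \<le> norm (w - y)"
proof -
  have u: "u \<in> X" "\<And>z. z \<in> X \<Longrightarrow> dist w u \<le> dist w z"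
    using assms(3) by (force simp: proj_def is_arg_min_def dist_norm norm_minus_commute not_less)+
  \<comment> \<open>The variational inequality at the closest point \<open>u\<close> gives the cross
    term in the expansion of \<open>(w - u) + (u - y)\<close> the right sign.\<close>
  have "inner (w - u) (y - u) \<le> 0"
    by (rule any_closest_point_dot) (use assms u in auto)
  then have "(norm (w - y))\<^sup>2 \<ge> (norm (w - u))\<^sup>2 + (norm (u - y))\<^sup>2"
    by (simp add: power2_norm_eq_inner algebra_simps inner_commute)
  then show ?thesis
    by (smt (verit) power2_le_imp_le norm_ge_zero zero_le_power2)
qed

lemma proj_norm_eq_infdist:
  assumes "y \<in> proj S z"
  shows "norm (y - z) = infdist z S"
proof (rule antisym)
  have y: "y \<in> S" "\<And>u. u \<in> S \<Longrightarrow> norm (y - z) \<le> norm (u - z)"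
    using assms by (force simp: proj_def is_arg_min_def not_less)+
  then show "norm (y - z) \<le> infdist z S"
    by (subst infdist_notempty) (auto intro!: cINF_greatest simp: dist_norm norm_minus_commute)
  show "infdist z S \<le> norm (y - z)"
    using infdist_le[OF y(1), of z] by (simp add: dist_norm norm_minus_commute)
qed

section \<open>Gradients and Frechet subgradients\<close>

lemma GDERIV_grad:
  fixes h :: "'a::euclidean_space \<Rightarrow> ereal"
  assumes "(\<lambda>y. real_of_ereal (h y)) differentiable (at x)"
  shows "GDERIV (\<lambda>y. real_of_ereal (h y)) x :> grad h x"
proof -
  obtain D where D: "((\<lambda>y. real_of_ereal (h y)) has_derivative D) (at x)"
    using assms by (auto simp: differentiable_def)
  have "linear D"
    using D has_derivative_linear by blast
  \<comment> \<open>\<open>D v\<close> equals the real inner product of \<open>D v\<close> with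
    \<open>1\<close>; moving \<open>D\<close> across yields the vector representing the linear
    form.\<close>
  then have "D = (\<lambda>v. v \<bullet> adjoint D 1)"
    using adjoint_works[of D] by (auto simp: fun_eq_iff)
  with D have G: "GDERIV (\<lambda>y. real_of_ereal (h y)) x :> adjoint D 1"
    by (simp add: gderiv_def)
  \<comment> \<open>Uniqueness is needed for the definite description in \<open>grad\<close> to
    denote this vector.\<close>
  have "E = adjoint D 1" if "GDERIV (\<lambda>y. real_of_ereal (h y)) x :> E" for E
  proof -
    have "(\<lambda>v. v \<bullet> E) = (\<lambda>v. v \<bullet> adjoint D 1)"
      using has_derivative_unique that G unfolding gderiv_def by blast
    then show ?thesis
      by (metis vector_eq_ldot)
  qed
  with G show ?thesis
    unfolding grad_def by (metis theI)
qed

text \<open>Move from \<open>z\<close> a fraction \<open>t\<close> towards \<open>y\<close>.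
  Convexity bounds the difference quotient of \<open>f + \<rho> h\<close> above by its increment
  from \<open>z\<close> to \<open>y\<close>. The Frechet inequality bounds the quotient of
  \<open>f\<close> below by \<open>\<zeta> \<bullet> (y - z)\<close> up to a vanishing error, and
  that of \<open>h\<close> tends to the directional derivative. The limit
  \<open>t \<rightarrow> 0\<close> gives the inequality; finiteness of the Bregman distance ensures
  that \<open>real_of_ereal\<close> hides no infinite value.\<close>

lemma frechet_subgradient_bregman:
  fixes h f :: "'a::euclidean_space \<Rightarrow> ereal"
  assumes h: "legendre_kernel h" and f: "proper f"
    and wc: "rel_weakly_convex \<rho> h f"
    and z: "z \<in> interior (effdom h)" and y: "y \<in> interior (effdom h)"
    and fy: "f y \<noteq> \<infinity>" and \<zeta>: "\<zeta> \<in> frechet_subdiff f z"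
  shows "real_of_ereal (f z) + \<zeta> \<bullet> (y - z) - \<rho> * real_of_ereal (bregman h y z) \<le> real_of_ereal (f y)"
    and "\<bar>bregman h y z\<bar> \<noteq> \<infinity>"
proof -
  let ?S = "interior (effdom h)"
  define F H where "F = (\<lambda>u. real_of_ereal (f u))" and "H = (\<lambda>u. real_of_ereal (h u))"
  have h_fin: "h u = ereal (H u)" if "u \<in> ?S" for u
  proof -
    have "h u \<noteq> \<infinity>" "h u \<noteq> -\<infinity>"
      using that interior_subset[of "effdom h"] h
      by (auto simp: effdom_def legendre_kernel_def proper_def)
    then show ?thesis
      by (cases "h u") (auto simp: H_def)
  qed
  have f_fin: "f u = ereal (F u)" if "f u \<noteq> \<infinity>" for u
    using that f by (cases "f u") (auto simp: F_def proper_def)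
  have breg: "bregman h y z = ereal (H y - H z - grad h z \<bullet> (y - z))"
    unfolding bregman_def by (simp add: h_fin z y)
  then show "\<bar>bregman h y z\<bar> \<noteq> \<infinity>"
    by simp
  have fz: "f z \<noteq> \<infinity>"
    using \<zeta> by (auto simp: frechet_subdiff_def)
  show "real_of_ereal (f z) + \<zeta> \<bullet> (y - z) - \<rho> * real_of_ereal (bregman h y z) \<le> real_of_ereal (f y)"
  \<comment> \<open>For \<open>y = z\<close> the path used below would be constant and never enter a
    punctured neighbourhood of \<open>z\<close>.\<close>
  proof (cases "y = z")
    case True
    then show ?thesis using breg by (simp add: zero_ereal_def)
  next
    case False
    define v where "v = y - z"
    have v: "v \<noteq> 0" using False by (simp add: v_def)
    obtain r where r: "r \<in> o[at z](\<lambda>u. norm (u - z))"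
      and ev: "\<forall>\<^sub>F u in at z. f u \<ge> f z + ereal (\<zeta> \<bullet> (u - z)) + ereal (r u)"
      using \<zeta> by (auto simp: frechet_subdiff_def)
    define p where "p t = z + t *\<^sub>R v" for t
    \<comment> \<open>As \<open>v\<close> is nonzero, \<open>p\<close> avoids \<open>z\<close> for
      \<open>t > 0\<close>, so facts that hold eventually in \<open>at z\<close> pull back to
      \<open>at_right 0\<close>.\<close>
    have "(p \<longlongrightarrow> z + 0 *\<^sub>R v) (at_right 0)"
      unfolding p_def by (intro tendsto_intros)
    then have p_lim: "filterlim p (at z) (at_right 0)"
      using v by (auto simp: filterlim_at p_def eventually_at_filter)
    have "((\<lambda>t. r (p t) / norm (p t - z)) \<longlongrightarrow> 0) (at_right 0)"
      using filterlim_compose[OF smalloD_tendsto[OF r] p_lim] .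
    \<comment> \<open>For \<open>t > 0\<close> the norm of \<open>p t - z\<close> is
      \<open>t * norm v\<close>, so this factor turns the little-o quotient into
      \<open>r (p t) / t\<close>.\<close>
    then have "((\<lambda>t. r (p t) / norm (p t - z) * norm v) \<longlongrightarrow> 0 * norm v) (at_right 0)"
      by (intro tendsto_intros)
    moreover have "\<forall>\<^sub>F t in at_right 0. r (p t) / norm (p t - z) * norm v = r (p t) / t"
      using v by (auto simp: eventually_at_filter p_def)
    ultimately have r_lim: "((\<lambda>t. r (p t) / t) \<longlongrightarrow> 0) (at_right 0)"
      using Lim_transform_eventually by fastforce
    have "GDERIV H z :> grad h z"
      unfolding H_def using h z by (intro GDERIV_grad) (auto simp: legendre_kernel_def)
    then have HD: "(H has_derivative (\<lambda>u. u \<bullet> grad h z)) (at (p 0))"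
      by (simp add: gderiv_def p_def)
    have "(p has_derivative (\<lambda>t. t *\<^sub>R v)) (at 0)"
      unfolding p_def by (auto intro!: derivative_eq_intros)
    from has_derivative_compose[OF this HD]
    have "((\<lambda>t. H (p t)) has_real_derivative (v \<bullet> grad h z)) (at 0)"
      by (simp add: has_field_derivative_def mult.commute[of _ "v \<bullet> grad h z"])
    then have "((\<lambda>t. (H (p t) - H z) / t) \<longlongrightarrow> v \<bullet> grad h z) (at 0)"
      by (simp add: DERIV_def p_def)
    then have H_lim: "((\<lambda>t. (H (p t) - H z) / t) \<longlongrightarrow> v \<bullet> grad h z) (at_right 0)"
      by (rule filterlim_mono) (auto simp: at_le)
    have "\<forall>\<^sub>F t::real in at_right 0. t < 1"
      by (rule order_tendstoD(2)[OF tendsto_ident_at]) simp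
    moreover have "\<forall>\<^sub>F t::real in at_right 0. 0 < t"
      by (simp add: eventually_at_filter)
    moreover have "\<forall>\<^sub>F t in at_right 0. f (p t) \<ge> f z + ereal (\<zeta> \<bullet> (p t - z)) + ereal (r (p t))"
      using ev p_lim by (auto simp: filterlim_iff)
    ultimately have "\<forall>\<^sub>F t in at_right 0.
        \<zeta> \<bullet> v + r (p t) / t + \<rho> * ((H (p t) - H z) / t) \<le> F y + \<rho> * H y - F z - \<rho> * H z"
    proof eventually_elim
      case (elim t)
      have p_eq: "p t = (1 - t) *\<^sub>R z + t *\<^sub>R y"
        by (simp add: p_def v_def algebra_simps)
      have conv: "convex ?S"
        using wc by (simp add: rel_weakly_convex_def ereal_convex_on_def)
      have pS: "p t \<in> ?S"
        unfolding p_eq using elim by (intro convexD_alt[OF conv z y]) auto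
      have "f (p t) + ereal \<rho> * h (p t)
          \<le> ereal (1 - t) * (f z + ereal \<rho> * h z) + ereal t * (f y + ereal \<rho> * h y)"
        using wc z y elim unfolding p_eq rel_weakly_convex_def ereal_convex_on_def by blast
      then have le: "f (p t) + ereal (\<rho> * H (p t))
          \<le> ereal ((1 - t) * (F z + \<rho> * H z) + t * (F y + \<rho> * H y))"
        by (simp add: h_fin pS z y f_fin[OF fz] f_fin[OF fy])
      \<comment> \<open>Finiteness of \<open>f\<close> between \<open>z\<close> and \<open>y\<close>
        is not given; the real upper bound from convexity provides it.\<close>
      then have "f (p t) \<noteq> \<infinity>"
        by auto
      note fp = f_fin[OF this]
      have "F (p t) + \<rho> * H (p t) \<le> (1 - t) * (F z + \<rho> * H z) + t * (F y + \<rho> * H y)"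
        using le by (simp add: fp)
      moreover have "F z + t * (\<zeta> \<bullet> v) + r (p t) \<le> F (p t)"
        using elim(3) unfolding fp f_fin[OF fz] by (simp add: p_def)
      ultimately have "t * (\<zeta> \<bullet> v) + r (p t) + \<rho> * (H (p t) - H z)
          \<le> t * (F y + \<rho> * H y - F z - \<rho> * H z)"
        by (simp add: algebra_simps)
      moreover have "t * (\<zeta> \<bullet> v + r (p t) / t + \<rho> * ((H (p t) - H z) / t))
          = t * (\<zeta> \<bullet> v) + r (p t) + \<rho> * (H (p t) - H z)"
        using elim by (simp add: field_simps)
      ultimately show ?case
        using elim by (metis mult_le_cancel_left_pos)
    qed
    moreover have "((\<lambda>t. \<zeta> \<bullet> v + r (p t) / t + \<rho> * ((H (p t) - H z) / t))
        \<longlongrightarrow> \<zeta> \<bullet> v + 0 + \<rho> * (v \<bullet> grad h z)) (at_right 0)"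
      by (intro tendsto_intros r_lim H_lim)
    ultimately have "\<zeta> \<bullet> v + 0 + \<rho> * (v \<bullet> grad h z) \<le> F y + \<rho> * H y - F z - \<rho> * H z"
      by (intro tendsto_upperbound) auto
    then show ?thesis
      unfolding breg F_def[symmetric]
      by (simp add: F_def v_def inner_commute algebra_simps)
  qed
qed

theorem theorem4p7:
  fixes h f :: "real ^ 'n \<Rightarrow> ereal"
    and X Xs :: "(real ^ 'n) set"
    and x :: "nat \<Rightarrow> real ^ 'n"
    and \<alpha> :: "nat \<Rightarrow> real"
    and fstar :: ereal
    and \<rho> \<mu> \<nu> G L \<tau> \<beta> :: real
  assumes "legendre_kernel h"
    and "X \<subseteq> interior (effdom h)" and "X \<noteq> {}" and "closed X" and "convex X"
    and "proper f" and "\<rho> > 0" and "rel_weakly_convex \<rho> h f"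
    and "\<And>z. z \<in> X \<Longrightarrow> finite_lipschitz_around f z"
    and "fstar = (INF z\<in>X. f z)" and "fstar > -\<infinity>"
    and "Xs = minimizers X f" and "Xs \<noteq> {}"
    and "\<mu> > 0"
    and sharpness: "\<And>z. z \<in> X \<Longrightarrow> ereal (\<mu> * infdist z Xs) \<le> f z - fstar"
    and "0 < \<nu>" and "\<nu> \<le> 1" and "G > 0"
    and bregman_growth:
      "\<And>z. z \<in> X \<Longrightarrow> infdist z Xs < (\<mu> / (\<rho> * G)) powr (1 / \<nu>) \<Longrightarrow>
         (INF y\<in>proj Xs z. bregman h y z) \<le> ereal (G * infdist z Xs powr (1 + \<nu>))"
    and "ereal L = Sup {ereal (norm \<zeta>) | \<zeta> z. z \<in> tube X Xs \<mu> \<rho> G \<nu> 1 \<and> \<zeta> \<in> frechet_subdiff f z}"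
    and "0 < L" and "\<tau> = \<mu> / L"
    and "0 < \<beta>" and "\<beta> < 1"
    and "x 0 \<in> tube X Xs \<mu> \<rho> G \<nu> \<beta>" and "psga X f \<alpha> x"
    and "filterlim (\<lambda>n. \<Sum>k<n. \<alpha> k) at_top sequentially"
    and "summable (\<lambda>k. (\<alpha> k)\<^sup>2)"
    and "\<And>k. 0 < \<alpha> k"
    and "\<And>k. \<alpha> k \<le> min 1 (2 * (1 - \<beta>) * \<tau>) * (\<beta> * \<mu> / (\<rho> * G)) powr (1 / \<nu>)"
  shows "(\<lambda>k. infdist (x k) Xs) \<longlonglongrightarrow> 0 \<and>
         (\<lambda>k. f (x k)) \<longlonglongrightarrow> fstar \<and>
         (\<forall>z r. strict_mono (r :: nat \<Rightarrow> nat) \<and> (x \<circ> r) \<longlonglongrightarrow> z \<longrightarrow> z \<in> Xs)"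
proof -

  \<comment> \<open>Constants and finiteness\<close>
  define d where "d k = infdist (x k) Xs" for k
  define R where "R = (\<beta> * \<mu> / (\<rho> * G)) powr (1 / \<nu>)"
  define c where "c = 2 * (1 - \<beta>) * \<tau>"
  note h = assms(1) and X_int = assms(2) and rho = assms(7) and mu = \<open>\<mu> > 0\<close>
    and alpha_pos = assms(29)
  have c: "0 < c"
    using \<open>\<beta> < 1\<close> mu \<open>0 < L\<close> by (simp add: c_def \<open>\<tau> = \<mu> / L\<close>)
  \<comment> \<open>Strictness comes from \<open>\<beta> < 1\<close>: the closed tube
    \<open>d k \<le> R\<close> lies in the open tube where the growth bound and the bound
    \<open>L\<close> apply.\<close>
  have R: "0 < R" "R < (\<mu> / (\<rho> * G)) powr (1 / \<nu>)"
    using \<open>0 < \<beta>\<close> \<open>\<beta> < 1\<close> mu rho \<open>0 < G\<close> \<open>0 < \<nu>\<close>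
    by (auto simp: R_def divide_strict_right_mono intro!: powr_less_mono2)
  have R_pow: "R powr \<nu> = \<beta> * \<mu> / (\<rho> * G)"
    using \<open>0 < \<beta>\<close> mu rho \<open>0 < G\<close> \<open>0 < \<nu>\<close> by (simp add: R_def powr_powr)
  have d0: "0 \<le> d k" for k
    by (simp add: d_def infdist_nonneg)

  \<comment> \<open>A minimizer lies in \<open>X\<close>, where \<open>f\<close> is finite, so
    \<open>fstar\<close> is a real number.\<close>
  obtain y0 where y0: "y0 \<in> X" "f y0 = fstar"
    using assms by (auto simp: minimizers_def)
  have f_fin: "\<bar>f u\<bar> \<noteq> \<infinity>" if "u \<in> X" for u
    using assms(9)[OF that] by (metis finite_lipschitz_around_def centre_in_ball)
  obtain fs where fs: "fstar = ereal fs"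
    using f_fin[OF y0(1)] y0(2) by (cases fstar) auto
  define F where "F u = real_of_ereal (f u)" for u
  have F: "f u = ereal (F u)" if "u \<in> X" for u
    using f_fin[OF that] by (cases "f u") (auto simp: F_def)
  have sharp: "\<mu> * infdist u Xs \<le> F u - fs" if "u \<in> X" for u
    using sharpness[OF that] by (simp add: F[OF that] fs)

  \<comment> \<open>Iterates and estimates for their subgradients\<close>
  obtain \<zeta> where \<zeta>: "\<And>k. \<zeta> k \<in> frechet_subdiff f (x k)"
    and upd0: "\<And>k. \<zeta> k = 0 \<Longrightarrow> x (Suc k) = x k"
    and upd: "\<And>k. \<zeta> k \<noteq> 0 \<Longrightarrow> x (Suc k) \<in> proj X (x k - (\<alpha> k / norm (\<zeta> k)) *\<^sub>R \<zeta> k)"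
    using \<open>psga X f \<alpha> x\<close> unfolding psga_def by metis
  have xX: "x k \<in> X" for k
  proof (induction k)
    case 0
    then show ?case using assms(25) by (simp add: tube_def)
  next
    case (Suc k)
    then show ?case
      using upd0[of k] upd[of k] by (cases "\<zeta> k = 0") (auto simp: proj_def is_arg_min_def)
  qed
  have \<zeta>_le: "norm (\<zeta> k) \<le> L" if "d k \<le> R" for k
  proof -
    have "x k \<in> tube X Xs \<mu> \<rho> G \<nu> 1"
      using that R(2) xX[of k] by (simp add: tube_def d_def)
    then have "ereal (norm (\<zeta> k)) \<le> ereal L"
      unfolding \<open>ereal L = _\<close> using \<zeta>[of k] by (intro Sup_upper) blast
    then show ?thesis by simp
  qed

  \<comment> \<open>The growth hypothesis bounds only an infimum over \<open>proj Xs (x k)\<close>, hence the slack \<open>\<epsilon>\<close>;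
    finiteness of that infimum is also what makes \<open>proj Xs (x k)\<close> nonempty.\<close>
  have nearest: "\<exists>y\<in>X. norm (y - x k) = d k \<and> y \<in> Xs \<and>
      F (x k) - fs \<le> \<zeta> k \<bullet> (x k - y) + \<rho> * G * d k powr (1 + \<nu>) + \<epsilon>"
    if "d k \<le> R" "0 < \<epsilon>" for k \<epsilon>
  proof -
    have "(INF y\<in>proj Xs (x k). bregman h y (x k)) \<le> ereal (G * d k powr (1 + \<nu>))"
      unfolding d_def using that R(2) by (intro bregman_growth xX) (simp add: d_def)
    \<comment> \<open>The slack is \<open>\<epsilon> / \<rho>\<close> because the Bregman term is
      later multiplied by \<open>\<rho>\<close>.\<close>
    also have "\<dots> < ereal (G * d k powr (1 + \<nu>) + \<epsilon> / \<rho>)"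
      using that(2) rho by simp
    finally obtain y where y: "y \<in> proj Xs (x k)"
      and breg: "bregman h y (x k) < ereal (G * d k powr (1 + \<nu>) + \<epsilon> / \<rho>)"
      by (auto simp: INF_less_iff)
    have yXs: "y \<in> Xs"
      using y by (simp add: proj_def is_arg_min_def)
    then have yX: "y \<in> X" and fy: "f y = fstar"
      using assms by (auto simp: minimizers_def)
    have "x k \<in> interior (effdom h)" "y \<in> interior (effdom h)" "f y \<noteq> \<infinity>"
      using X_int xX[of k] yX f_fin[OF yX] by auto
    note bound = frechet_subgradient_bregman[OF h \<open>proper f\<close> \<open>rel_weakly_convex \<rho> h f\<close> this \<zeta>]
    have sub: "F (x k) + \<zeta> k \<bullet> (y - x k) - \<rho> * real_of_ereal (bregman h y (x k)) \<le> F y"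
      unfolding F_def by (rule bound(1))
    note fin = bound(2)
    have "real_of_ereal (bregman h y (x k)) < G * d k powr (1 + \<nu>) + \<epsilon> / \<rho>"
      using breg fin by (cases "bregman h y (x k)") auto
    then have "\<rho> * real_of_ereal (bregman h y (x k)) \<le> \<rho> * (G * d k powr (1 + \<nu>) + \<epsilon> / \<rho>)"
      using rho by (intro mult_left_mono) auto
    also have "\<dots> = \<rho> * G * d k powr (1 + \<nu>) + \<epsilon>"
      using rho by (simp add: field_simps)
    finally have "F (x k) - fs \<le> \<zeta> k \<bullet> (x k - y) + \<rho> * G * d k powr (1 + \<nu>) + \<epsilon>"
      using sub F[OF yX] fy fs by (simp add: inner_diff_right)
    then show ?thesis
      using proj_norm_eq_infdist[OF y] yX yXs by (auto simp: d_def)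
  qed
  \<comment> \<open>\<open>R\<close> is the distance at which the growth error equals the fraction
    \<open>\<beta>\<close> of the sharpness term \<open>\<mu> * d k\<close>; below it the error is
    no larger than that fraction.\<close>
  have growth_le: "\<rho> * G * d k powr (1 + \<nu>) \<le> \<beta> * \<mu> * d k" if "d k \<le> R" for k
  proof -
    have "d k powr \<nu> \<le> \<beta> * \<mu> / (\<rho> * G)"
      unfolding R_pow[symmetric] using that d0 \<open>0 < \<nu>\<close> by (intro powr_mono2) auto
    then have "\<rho> * G * d k powr \<nu> \<le> \<beta> * \<mu>"
      using rho \<open>0 < G\<close> by (simp add: pos_le_divide_eq mult.commute)
    then have "\<rho> * G * d k powr \<nu> * d k \<le> \<beta> * \<mu> * d k"
      using d0 by (intro mult_right_mono)
    moreover have "d k powr (1 + \<nu>) = d k powr \<nu> * d k"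
      using d0[of k] by (cases "d k = 0") (auto simp: powr_add)
    ultimately show ?thesis by (simp add: mult.assoc)
  qed
  \<comment> \<open>Sharpness supplies \<open>\<mu> * d k\<close> and the growth error consumes at
    most the fraction \<open>\<beta>\<close> of it.\<close>
  have descent_dir: "\<exists>y\<in>X. norm (y - x k) = d k \<and> y \<in> Xs \<and> (1 - \<beta>) * \<mu> * d k - \<epsilon> \<le> \<zeta> k \<bullet> (x k - y)"
    if dk: "d k \<le> R" and \<epsilon>: "0 < \<epsilon>" for k \<epsilon>
  proof -
    obtain y where y: "y \<in> X" "norm (y - x k) = d k" "y \<in> Xs"
      "F (x k) - fs \<le> \<zeta> k \<bullet> (x k - y) + \<rho> * G * d k powr (1 + \<nu>) + \<epsilon>"
      using nearest[OF dk \<epsilon>] by blast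
    have "(1 - \<beta>) * \<mu> * d k = \<mu> * d k - \<beta> * \<mu> * d k"
      by (simp add: algebra_simps)
    then have "(1 - \<beta>) * \<mu> * d k - \<epsilon> \<le> \<zeta> k \<bullet> (x k - y)"
      using sharp[OF xX[of k]] growth_le[OF dk] y(4) unfolding d_def[symmetric] by linarith
    with y show ?thesis by blast
  qed

  \<comment> \<open>One-step recursion for the squared distance\<close>
  have rec: "(d (Suc k))\<^sup>2 \<le> (d k)\<^sup>2 - c * \<alpha> k * d k + (\<alpha> k)\<^sup>2" if dk: "d k \<le> R" for k
  proof (cases "\<zeta> k = 0")
    case True
    \<comment> \<open>A zero subgradient in the tube can occur only at distance zero, and then the
      iterate stays put.\<close>
    have "(1 - \<beta>) * \<mu> * d k \<le> 0"
    proof (rule field_le_epsilon)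
      fix \<epsilon> :: real assume "0 < \<epsilon>"
      from descent_dir[OF dk this] show "(1 - \<beta>) * \<mu> * d k \<le> 0 + \<epsilon>"
        by (auto simp: True)
    qed
    then have "d k = 0"
      using d0[of k] \<open>\<beta> < 1\<close> mu by (simp add: mult_le_0_iff)
    then show ?thesis
      using upd0[OF True] by (simp add: d_def)
  next
    case False
    define a where "a = \<alpha> k / norm (\<zeta> k)"
    have a: "0 < a" "a * norm (\<zeta> k) = \<alpha> k"
      using False alpha_pos[of k] by (auto simp: a_def)
    have "(d (Suc k))\<^sup>2 \<le> (d k)\<^sup>2 - 2 * a * ((1 - \<beta>) * \<mu> * d k) + (\<alpha> k)\<^sup>2"
    proof (rule field_le_epsilon)
      fix e :: real assume "0 < e"
      \<comment> \<open>Expanding the square multiplies the slack by \<open>2 * a\<close>, which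
        turns it into \<open>e\<close>.\<close>
      define \<epsilon> where "\<epsilon> = e / (2 * a)"
      have "0 < \<epsilon>" using \<open>0 < e\<close> a by (simp add: \<epsilon>_def)
      then obtain y where y: "y \<in> X" "norm (y - x k) = d k" "y \<in> Xs"
        "(1 - \<beta>) * \<mu> * d k - \<epsilon> \<le> \<zeta> k \<bullet> (x k - y)"
        using descent_dir[OF dk] by blast
      have "d (Suc k) \<le> norm (x (Suc k) - y)"
        using infdist_le[OF y(3)] by (simp add: d_def dist_norm)
      also have "\<dots> \<le> norm (x k - a *\<^sub>R \<zeta> k - y)"
        unfolding a_def by (rule proj_nonexpansive[OF \<open>convex X\<close> \<open>closed X\<close> upd[OF False] y(1)])
      finally have "(d (Suc k))\<^sup>2 \<le> (norm (x k - a *\<^sub>R \<zeta> k - y))\<^sup>2"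
        using d0 by (intro power_mono)
      also have "\<dots> = (norm ((x k - y) - a *\<^sub>R \<zeta> k))\<^sup>2"
        by (simp add: algebra_simps)
      also have "\<dots> = (norm (y - x k))\<^sup>2 - 2 * a * (\<zeta> k \<bullet> (x k - y)) + (a * norm (\<zeta> k))\<^sup>2"
        unfolding power_mult_distrib power2_norm_eq_inner
        by (simp add: algebra_simps inner_commute power2_eq_square)
      also have "\<dots> = (d k)\<^sup>2 - 2 * a * (\<zeta> k \<bullet> (x k - y)) + (\<alpha> k)\<^sup>2"
        by (simp add: y(2) a(2))
      also have "\<dots> \<le> (d k)\<^sup>2 - 2 * a * ((1 - \<beta>) * \<mu> * d k - \<epsilon>) + (\<alpha> k)\<^sup>2"
        using y(4) a(1) by simp
      also have "\<dots> = (d k)\<^sup>2 - 2 * a * ((1 - \<beta>) * \<mu> * d k) + (\<alpha> k)\<^sup>2 + e"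
        using a(1) by (simp add: \<epsilon>_def field_simps)
      finally show "(d (Suc k))\<^sup>2 \<le> (d k)\<^sup>2 - 2 * a * ((1 - \<beta>) * \<mu> * d k) + (\<alpha> k)\<^sup>2 + e" .
    qed
    \<comment> \<open>Normalizing by \<open>norm (\<zeta> k) \<le> L\<close> makes the step factor
      \<open>a\<close> at least \<open>\<alpha> k / L\<close>; this is where
      \<open>\<tau> = \<mu> / L\<close> enters.\<close>
    moreover have "c * \<alpha> k * d k \<le> 2 * a * ((1 - \<beta>) * \<mu> * d k)"
    proof -
      have "\<alpha> k / L \<le> a"
        unfolding a_def using \<zeta>_le[OF dk] \<open>0 < L\<close> False alpha_pos[of k] by (intro divide_left_mono) auto
      then have "\<alpha> k / L * (2 * (1 - \<beta>) * \<mu> * d k) \<le> a * (2 * (1 - \<beta>) * \<mu> * d k)"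
        using \<open>\<beta> < 1\<close> mu d0 by (intro mult_right_mono) auto
      then show ?thesis
        by (simp add: c_def \<open>\<tau> = \<mu> / L\<close> algebra_simps)
    qed
    ultimately show ?thesis by linarith
  qed

  \<comment> \<open>Invariance of the closed tube\<close>
  have dR: "d k \<le> R" for k
  proof (induction k)
    case 0
    then show ?case using assms(25) by (simp add: tube_def d_def R_def)
  next
    case (Suc k)
    have "\<alpha> k \<le> min 1 c * R"
      using assms(30)[of k] by (simp add: c_def R_def)
    moreover have "min 1 c * R \<le> 1 * R" "min 1 c * R \<le> c * R"
      using R(1) by (intro mult_right_mono; simp)+
    ultimately have \<alpha>R: "\<alpha> k \<le> R" "\<alpha> k \<le> c * R"
      by linarith+
    \<comment> \<open>The right-hand side of the recursion, as a quadratic in \<open>d k\<close>, is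
      interpolated between \<open>0\<close> and \<open>R\<close>; the last summand is the convexity
      gap. The endpoint \<open>0\<close> needs \<open>\<alpha> k \<le> R\<close> and the endpoint
      \<open>R\<close> needs \<open>\<alpha> k \<le> c * R\<close>, which are the two entries of the
      minimum in the step-size cap.\<close>
    have "R * (R\<^sup>2 - ((d k)\<^sup>2 - c * \<alpha> k * d k + (\<alpha> k)\<^sup>2))
        = (R - d k) * (R\<^sup>2 - (\<alpha> k)\<^sup>2) + d k * (\<alpha> k * (c * R - \<alpha> k)) + R * d k * (R - d k)"
      by (simp add: algebra_simps power2_eq_square)
    also have "\<dots> \<ge> 0"
    proof -
      have "(\<alpha> k)\<^sup>2 \<le> R\<^sup>2"
        using \<alpha>R(1) alpha_pos[of k] by (intro power_mono) auto
      then show ?thesis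
        using R(1) d0[of k] Suc \<alpha>R(2) alpha_pos[of k] by simp
    qed
    finally have "(d k)\<^sup>2 - c * \<alpha> k * d k + (\<alpha> k)\<^sup>2 \<le> R\<^sup>2"
      using R(1) by (simp add: zero_le_mult_iff)
    with rec[OF Suc] have "(d (Suc k))\<^sup>2 \<le> R\<^sup>2" by linarith
    then show ?case
      using power2_le_imp_le[of "d (Suc k)" R] R(1) by simp
  qed
  have d_lim: "d \<longlonglongrightarrow> 0"
    using d0 alpha_pos c rec[OF dR] assms(27,28) by (rule tendsto_zero_of_square_recursion[where \<alpha> = \<alpha>])

  \<comment> \<open>Convergence of the function values\<close>
  have "F (x k) - fs \<le> L * d k + \<beta> * \<mu> * d k" for k
  proof (rule field_le_epsilon)
    fix \<epsilon> :: real assume "0 < \<epsilon>"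
    from nearest[OF dR this] obtain y where y: "norm (y - x k) = d k"
      "F (x k) - fs \<le> \<zeta> k \<bullet> (x k - y) + \<rho> * G * d k powr (1 + \<nu>) + \<epsilon>"
      by blast
    \<comment> \<open>Cauchy-Schwarz controls the linear term by \<open>L * d k\<close>; with
      \<open>growth_le\<close> the whole bound becomes linear in \<open>d k\<close>.\<close>
    have "\<zeta> k \<bullet> (x k - y) \<le> norm (\<zeta> k) * norm (x k - y)"
      by (rule norm_cauchy_schwarz)
    also have "\<dots> \<le> L * d k"
      using \<zeta>_le[OF dR, of k] d0[of k] y(1) by (simp add: norm_minus_commute mult_right_mono)
    finally show "F (x k) - fs \<le> L * d k + \<beta> * \<mu> * d k + \<epsilon>"
      using growth_le[OF dR, of k] y(2) by linarith
  qed
  then have up: "F (x k) \<le> fs + (L * d k + \<beta> * \<mu> * d k)" for k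
    by (simp add: algebra_simps)
  have lo: "fs \<le> F (x k)" for k
    using sharp[OF xX[of k]] mu infdist_nonneg[of "x k" Xs] by (smt (verit) mult_nonneg_nonneg)
  have "(\<lambda>k. fs + (L * d k + \<beta> * \<mu> * d k)) \<longlonglongrightarrow> fs + (L * 0 + \<beta> * \<mu> * 0)"
    by (intro tendsto_intros d_lim)
  then have F_lim: "(\<lambda>k. F (x k)) \<longlonglongrightarrow> fs"
    using tendsto_sandwich[of "\<lambda>_. fs" "\<lambda>k. F (x k)" sequentially
        "\<lambda>k. fs + (L * d k + \<beta> * \<mu> * d k)" fs] lo up
    by simp
  then have f_lim: "(\<lambda>k. f (x k)) \<longlonglongrightarrow> fstar"
    by (simp add: F[OF xX] fs)

  \<comment> \<open>Cluster points\<close>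
  have cluster: "z \<in> Xs" if r: "strict_mono r" "(x \<circ> r) \<longlonglongrightarrow> z" for z and r :: "nat \<Rightarrow> nat"
  proof -
    have zX: "z \<in> X"
      using closed_sequentially[OF \<open>closed X\<close> _ r(2)] xX by simp
    obtain e K where e: "0 < e" and lip: "K-lipschitz_on (ball z e) F"
      using assms(9)[OF zX] unfolding finite_lipschitz_around_def F_def by blast
    \<comment> \<open>The Lipschitz ball is open in the whole space, so \<open>F\<close> is
      continuous at \<open>z\<close> and the limit of the values along the subsequence is attained
      there.\<close>
    have "isCont F z"
      using lipschitz_on_continuous_on[OF lip] e by (simp add: continuous_on_eq_continuous_at)
    then have "(\<lambda>k. F ((x \<circ> r) k)) \<longlonglongrightarrow> F z"
      using r(2) by (rule isCont_tendsto_compose)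
    moreover have "(\<lambda>k. F ((x \<circ> r) k)) \<longlonglongrightarrow> fs"
      using LIMSEQ_subseq_LIMSEQ[OF F_lim r(1)] by (simp add: o_def)
    ultimately have "F z = fs"
      using LIMSEQ_unique by blast
    then show ?thesis
      using zX assms(10) F[OF zX] fs by (simp add: \<open>Xs = minimizers X f\<close> minimizers_def)
  qed
  show ?thesis
    using d_lim[unfolded d_def] f_lim cluster by blast
qed

end
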